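(* Let $n \ge 2$, $m$, $\delta$ be integers with $\delta \geq n$ and $m \leq 3\delta - 5$. Let $G$ be a bipartite graph with bipartition $(X,Y)$, $|X|=n$, $|Y|=m$, and every $x\in X$ of degree at least $\delta$. Suppose that for each $A \subseteq X$ with $|A| \geq 3$ there is $B \subseteq Y$ with $|B| \geq |A|$ such that the induced subgraph $G[A \cup B]$ is 2-connected. Then $G$ is $X$-super-pancyclic, i.e., for every $X' \subseteq X$ with $|X'| \geq 3$, $G$ has a cycle $C$ with $V(C) \cap X = X'$. *)

theory Defs
  imports Main
begin

definition bipartite_graph :: "('a \<Rightarrow> 'a \<Rightarrow> bool) \<Rightarrow> 'a set \<Rightarrow> 'a set \<Rightarrow> bool" where
  "bipartite_graph E X Y \<longleftrightarrow>
     finite X \<and> finite Y \<and> X \<inter> Y = {} \<and>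
     (\<forall>u v. E u v \<longrightarrow> E v u) \<and>
     (\<forall>u v. E u v \<longrightarrow> (u \<in> X \<and> v \<in> Y) \<or> (u \<in> Y \<and> v \<in> X))"

definition degree :: "('a \<Rightarrow> 'a \<Rightarrow> bool) \<Rightarrow> 'a \<Rightarrow> nat" where
  "degree E v = card {w. E v w}"

definition connected_induced :: "('a \<Rightarrow> 'a \<Rightarrow> bool) \<Rightarrow> 'a set \<Rightarrow> bool" where
  "connected_induced E S \<longleftrightarrow> S \<noteq> {} \<and>
     (\<forall>u\<in>S. \<forall>v\<in>S. (\<lambda>a b. a \<in> S \<and> b \<in> S \<and> E a b)\<^sup>*\<^sup>* u v)"

definition two_connected_induced :: "('a \<Rightarrow> 'a \<Rightarrow> bool) \<Rightarrow> 'a set \<Rightarrow> bool" where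
  "two_connected_induced E S \<longleftrightarrow> finite S \<and> card S \<ge> 3 \<and> connected_induced E S \<and>
     (\<forall>v\<in>S. connected_induced E (S - {v}))"

definition is_cycle :: "('a \<Rightarrow> 'a \<Rightarrow> bool) \<Rightarrow> 'a list \<Rightarrow> bool" where
  "is_cycle E vs \<longleftrightarrow> length vs \<ge> 3 \<and> distinct vs \<and>
     (\<forall>i < length vs - 1. E (vs ! i) (vs ! Suc i)) \<and> E (last vs) (hd vs)"

definition X_super_pancyclic :: "('a \<Rightarrow> 'a \<Rightarrow> bool) \<Rightarrow> 'a set \<Rightarrow> bool" where
  "X_super_pancyclic E X \<longleftrightarrow>
     (\<forall>X' \<subseteq> X. card X' \<ge> 3 \<longrightarrow> (\<exists>C. is_cycle E C \<and> set C \<inter> X = X'))"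

end

theory Submission
  imports Defs
begin

text \<open>
  Induct on the size \<open>n\<close> of the target set \<open>A\<close>. Take \<open>x \<in> A\<close> and a cycle \<open>C\<close> through exactly
  \<open>A - {x}\<close>, and let \<open>W\<close> be its \<open>n - 1\<close> vertices in \<open>Y\<close>. Two vertices of \<open>A\<close> are joined if they are the
  ends of a path with vertex set \<open>A \<union> W\<close>; if no cycle covers \<open>A\<close>, joined vertices have no common
  neighbour outside \<open>W\<close>. Hence in a good set (one of pairwise joined vertices) the neighbourhoods
  outside \<open>W\<close> are disjoint, and \<open>m \<le> 3\<delta> - 5\<close> bounds the number of edges missing between a good set
  and \<open>W\<close>. Conversely, reversing both end segments of a path shows that if \<open>u\<close>, \<open>v\<close> are joined and miss
  \<open>c u\<close>, \<open>c v\<close> vertices of \<open>W\<close>, there is a good set of size at least \<open>n - c u - c v\<close>. Applied to a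
  maximum good set of size \<open>n - \<kappa>\<close> the two bounds give \<open>(\<kappa> - 2)(\<kappa> - (n - 4)) \<ge> 0\<close>, which leaves only
  extreme cases. These are excluded by the good set formed by \<open>x\<close> and the predecessors on \<open>C\<close> of the
  neighbours of \<open>x\<close>, since \<open>x\<close> itself misses many vertices of \<open>W\<close>. The condition on three-element
  subsets guarantees that \<open>x\<close> has at least two neighbours on \<open>C\<close>.
\<close>

section \<open>Alternating paths and cycles\<close>

locale bigraph =
  fixes E :: "'a \<Rightarrow> 'a \<Rightarrow> bool" and A Y :: "'a set"
  assumes sym: "E u v \<Longrightarrow> E v u"
    and bip: "E u v \<Longrightarrow> u \<in> Y \<longleftrightarrow> v \<notin> Y"
    and finite_A: "finite A" and finite_Y: "finite Y" and disjoint: "A \<inter> Y = {}"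
begin

lemma successively_rev_E: "successively E (rev P) \<longleftrightarrow> successively E P"
  unfolding successively_rev by (rule successively_cong) (auto intro: sym)

lemma is_cycleI:
  assumes "length C \<ge> 3" "distinct C" "successively E C" "E (last C) (hd C)"
  shows "is_cycle E C"
  using assms unfolding is_cycle_def successively_conv_nth by auto

lemma is_cycleD:
  assumes "is_cycle E C"
  shows "length C \<ge> 3" "distinct C" "successively E C" "E (last C) (hd C)" "C \<noteq> []"
  using assms unfolding is_cycle_def successively_conv_nth by auto

text \<open>Consecutive vertices pair off from the front, and one is left over exactly when the path
  ends on the side where it began. For a cycle cut open this yields the size of
  \<open>W\<close>.\<close>

lemma alternating_card:
  assumes "successively E P" "distinct P" "P \<noteq> []" "hd P \<notin> Y"
  shows "card (set P - Y) = card (set P \<inter> Y) + (if last P \<in> Y then 0 else 1)"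
  using assms
proof (induction P rule: induct_list012)
  case (3 a b P)
  have b: "b \<in> Y" "a \<notin> Y" "a \<noteq> b" "a \<notin> set P" "b \<notin> set P" using 3 bip by auto
  have s: "set (a # b # P) - Y = insert a (set P - Y)" "set (a # b # P) \<inter> Y = insert b (set P \<inter> Y)"
    using b by auto
  show ?case
  proof (cases P)
    case Nil
    then show ?thesis using b s by simp
  next
    case (Cons c P')
    have "hd P \<notin> Y" using 3(3) b(1) bip[of b c] Cons by auto
    then have "card (set P - Y) = card (set P \<inter> Y) + (if last P \<in> Y then 0 else 1)"
      using 3(1,3,4,5) Cons by (auto simp: 3)
    then show ?thesis unfolding s using b Cons by (auto simp: card_insert_if)
  qed
qed (auto simp: insert_Diff_if)

section \<open>Spanning paths, good sets and reversal of end segments\<close>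

definition ham :: "'a set \<Rightarrow> 'a list \<Rightarrow> bool" where
  "ham W P \<longleftrightarrow> P \<noteq> [] \<and> distinct P \<and> successively E P \<and> set P = A \<union> W"

definition joined :: "'a set \<Rightarrow> 'a \<Rightarrow> 'a \<Rightarrow> bool" where
  "joined W u v \<longleftrightarrow> (\<exists>P. ham W P \<and> hd P = u \<and> last P = v)"

definition good :: "'a set \<Rightarrow> 'a set \<Rightarrow> bool" where
  "good W I \<longleftrightarrow> I \<subseteq> A \<and> (\<forall>u\<in>I. \<forall>v\<in>I. u \<noteq> v \<longrightarrow> joined W u v)"

definition missing :: "'a set \<Rightarrow> 'a \<Rightarrow> nat" where
  "missing W u = card {y \<in> W. \<not> E u y}"

definition outside :: "'a set \<Rightarrow> 'a \<Rightarrow> 'a set" where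
  "outside W u = {y \<in> Y - W. E u y}"

lemma ham_rev: "ham W P \<Longrightarrow> ham W (rev P)"
  unfolding ham_def by (auto simp: successively_rev_E simp del: successively_rev)

lemma joined_sym: "joined W u v \<Longrightarrow> joined W v u"
  unfolding joined_def using ham_rev by (metis hd_rev last_rev)

text \<open>Both end segments are reversed: the old ends of the path get attached to
  \<open>M\<close>, and the vertices next to \<open>M\<close> become the new ends.\<close>

lemma flip_both:
  assumes "ham W (F @ M @ G)" "F \<noteq> []" "M \<noteq> []" "G \<noteq> []"
    and "E (hd F) (hd M)" "E (last M) (last G)"
  shows "joined W (last F) (hd G)"
proof -
  have "ham W (rev F @ M @ rev G)"
    using assms unfolding ham_def
    by (auto simp: successively_append_iff successively_rev_E hd_rev last_rev simp del: successively_rev)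
  then show ?thesis
    unfolding joined_def using assms(2-4) by (metis append_is_Nil_conv hd_append2 hd_rev last_append last_rev rev_is_Nil_conv)
qed

lemma flip_end:
  assumes "ham W (F @ G)" "F \<noteq> []" "G \<noteq> []" "E (last F) (last G)"
  shows "joined W (hd F) (hd G)"
proof -
  have "ham W (F @ rev G)"
    using assms unfolding ham_def
    by (auto simp: successively_append_iff successively_rev_E hd_rev last_rev simp del: successively_rev)
  then show ?thesis
    unfolding joined_def using assms(2-3) by (metis append_is_Nil_conv hd_append2 last_append last_rev rev_is_Nil_conv)
qed

text \<open>
  The path can be reversed up to \<open>a\<close>, making \<open>a\<close> its first vertex, unless \<open>a\<close> is blocked.
\<close>

definition blocked :: "'a list \<Rightarrow> 'a set" where
  "blocked P = {a \<in> A. \<exists>F y G. P = F @ a # y # G \<and> \<not> E (hd P) y}"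

text \<open>A blocked vertex is determined by its successor on the path, which lies in
  \<open>W\<close> and is missed by \<open>hd P\<close>.\<close>

lemma card_blocked:
  assumes "ham W P" "W \<subseteq> Y"
  shows "card (blocked P) \<le> missing W (hd P)"
proof -
  have finW: "finite W" using assms(2) finite_Y finite_subset by auto
  have "blocked P \<subseteq> (\<lambda>y. last (takeWhile (\<lambda>z. z \<noteq> y) P)) ` {y \<in> W. \<not> E (hd P) y}"
  proof
    fix a assume "a \<in> blocked P"
    then obtain F y G where P: "P = F @ a # y # G" "\<not> E (hd P) y" "a \<in> A" unfolding blocked_def by blast
    have d: "distinct P" "successively E P" "set P = A \<union> W" using assms(1) unfolding ham_def by auto
    then have "E a y" using P(1) by (auto simp: successively_append_iff)
    then have "y \<in> Y" using bip P(3) disjoint by blast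
    moreover have "y \<in> A \<union> W" using P(1) d(3) by auto
    ultimately have "y \<in> W" using disjoint by auto
    moreover have "takeWhile (\<lambda>z. z \<noteq> y) P = F @ [a]"
      using d(1) unfolding P(1) by (auto simp: takeWhile_append)
    ultimately show "a \<in> (\<lambda>y. last (takeWhile (\<lambda>z. z \<noteq> y) P)) ` {y \<in> W. \<not> E (hd P) y}"
      using P(2) by force
  qed
  then show ?thesis unfolding missing_def
    by (rule surj_card_le[rotated]) (use finW in auto)
qed

text \<open>For \<open>p\<close> before \<open>q\<close> on the path, the initial segment ending in
  \<open>p\<close> and the final segment starting in \<open>q\<close> can both be reversed, which
  makes \<open>p\<close> and \<open>q\<close> the ends. Either of two vertices may come first, so
  both kinds of blocked vertices are removed.\<close>

lemma good_unblocked: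
  assumes "ham W P" "hd P \<in> A" "last P \<in> A"
  shows "good W (A - blocked P - blocked (rev P))"
proof -
  have main: "joined W p q" if P: "P = F @ p # G @ q # H" and pq: "p \<in> A" "q \<in> A"
    "p \<notin> blocked P" "q \<notin> blocked (rev P)" for p q F G H
  proof -
    have d: "successively E P" using assms(1) unfolding ham_def by auto
    have Gn: "G \<noteq> []"
    proof
      assume "G = []"
      then have "E p q" using d unfolding P by (auto simp: successively_append_iff)
      then show False using bip pq disjoint by auto
    qed
    have "E (hd P) (hd G)"
    proof -
      have "P = F @ p # hd G # (tl G @ q # H)" using P Gn by (cases G) auto
      then show ?thesis using pq unfolding blocked_def by blast
    qed
    moreover have "E (last P) (last G)"
    proof -
      have "rev P = rev H @ q # last G # (rev (butlast G) @ p # rev F)"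
        unfolding P using Gn by (metis append_Cons append_Nil append_assoc append_butlast_last_id rev.simps(2) rev_append rev_rev_ident)
      then have "E (hd (rev P)) (last G)" using pq unfolding blocked_def by blast
      then show ?thesis by (simp add: hd_rev)
    qed
    ultimately have "joined W (last (F @ [p])) (hd (q # H))"
      using assms(1) Gn P by (intro flip_both[of W _ G]) (auto simp: hd_append intro: sym)
    then show ?thesis by simp
  qed
  show ?thesis unfolding good_def
  proof (intro conjI ballI impI)
    fix p q assume p: "p \<in> A - blocked P - blocked (rev P)" and q: "q \<in> A - blocked P - blocked (rev P)" and "p \<noteq> q"
    have "p \<in> set P" "q \<in> set P" using assms(1) p q unfolding ham_def by auto
    then obtain F G where P: "P = F @ p # G" by (meson split_list)
    consider "q \<in> set F" | "q \<in> set G" using \<open>q \<in> set P\<close> \<open>p \<noteq> q\<close> P by auto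
    then show "joined W p q"
    proof cases
      case 1
      then obtain F1 F2 where "F = F1 @ q # F2" by (meson split_list)
      then have "joined W q p" using main[of F1 q F2 p G] P p q by auto
      then show ?thesis by (rule joined_sym)
    next
      case 2
      then obtain G1 G2 where "G = G1 @ q # G2" by (meson split_list)
      then show ?thesis using main[of F p G1 q G2] P p q by auto
    qed
  qed auto
qed

lemma card_unblocked:
  assumes "ham W P" "W \<subseteq> Y"
  shows "card A \<le> card (A - blocked P - blocked (rev P)) + missing W (hd P) + missing W (last P)"
proof -
  have "card (blocked P) \<le> missing W (hd P)" "card (blocked (rev P)) \<le> missing W (last P)"
    using card_blocked[OF assms] card_blocked[OF ham_rev[OF assms(1)] assms(2)] by (auto simp: hd_rev)
  moreover have "card A \<le> card (A - blocked P - blocked (rev P)) + card (blocked P) + card (blocked (rev P))"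
  proof -
    have f: "finite (blocked P)" "finite (blocked (rev P))" unfolding blocked_def using finite_A by auto
    show ?thesis using diff_card_le_card_Diff[OF f(1), of A] diff_card_le_card_Diff[OF f(2), of "A - blocked P"] by linarith
  qed
  ultimately show ?thesis by linarith
qed

lemma joined_good:
  assumes "joined W u v" "u \<in> A" "v \<in> A" "W \<subseteq> Y"
  obtains I where "good W I" "card A \<le> card I + missing W u + missing W v"
  using assms good_unblocked card_unblocked unfolding joined_def by metis

text \<open>Reversing the final segment from \<open>w\<close> on keeps \<open>u\<close> as one end
  and makes \<open>w\<close> the other; this fails only if the predecessor of \<open>w\<close> is
  missed by \<open>v\<close>.\<close>

lemma card_not_joined:
  assumes "joined W u v" "W \<subseteq> Y"
  shows "card {w \<in> A. w \<noteq> u \<and> \<not> joined W u w} \<le> missing W v"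
proof -
  obtain P where P: "ham W P" "hd P = u" "last P = v" using assms unfolding joined_def by auto
  have "{w \<in> A. w \<noteq> u \<and> \<not> joined W u w} \<subseteq> blocked (rev P)"
  proof
    fix w assume w: "w \<in> {w \<in> A. w \<noteq> u \<and> \<not> joined W u w}"
    then have "w \<in> set P" using P(1) unfolding ham_def by auto
    then obtain F G where FG: "P = F @ w # G" by (meson split_list)
    then have Fn: "F \<noteq> []" using w P(2) by auto
    then have "rev P = rev G @ w # last F # rev (butlast F)"
      unfolding FG by (metis append_Cons append_Nil append_assoc append_butlast_last_id rev.simps(2) rev_append rev_rev_ident)
    moreover have "\<not> E (hd (rev P)) (last F)"
    proof
      assume "E (hd (rev P)) (last F)"
      then have "E (last F) (last (w # G))" using FG by (auto simp: hd_rev intro: sym split: if_splits)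
      then have "joined W (hd F) (hd (w # G))" using flip_end[of W F "w # G"] P(1) FG Fn by auto
      then show False using w P(2) FG Fn by auto
    qed
    ultimately show "w \<in> blocked (rev P)" using w unfolding blocked_def by blast
  qed
  moreover have "finite (blocked (rev P))" unfolding blocked_def using finite_A by auto
  ultimately have "card {w \<in> A. w \<noteq> u \<and> \<not> joined W u w} \<le> card (blocked (rev P))" by (rule card_mono[rotated])
  also have "\<dots> \<le> missing W v" using card_blocked[OF ham_rev[OF P(1)] assms(2)] P(3) by (simp add: hd_rev)
  finally show ?thesis .
qed

end

section \<open>Counting missing edges in a critical configuration\<close>

lemma sum_pairwise_lower:
  fixes c :: "'b \<Rightarrow> nat"
  assumes "finite I" "I \<noteq> {}" "\<And>u v. u \<in> I \<Longrightarrow> v \<in> I \<Longrightarrow> u \<noteq> v \<Longrightarrow> \<kappa> \<le> c u + c v"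
  obtains a d where "a \<le> d" "\<kappa> \<le> a + d" "a + (card I - 1) * d \<le> sum c I"
    "\<And>u. u \<in> I \<Longrightarrow> a \<le> c u"
proof -
  obtain u0 where u0: "u0 \<in> I" "\<And>u. u \<in> I \<Longrightarrow> c u0 \<le> c u"
    using ex_min_if_finite[of "c ` I"] assms(1,2) by (metis (no_types, lifting) arg_min_if_finite(1) arg_min_least)
  \<comment> \<open>The minimum is attained at \<open>u0\<close>, so every other element has value
    at least \<open>c u0\<close> and, by the pair bound, at least
    \<open>\<kappa> - c u0\<close>.\<close>
  define d where "d = max (c u0) (\<kappa> - c u0)"
  have "(card (I - {u0})) * d \<le> sum c (I - {u0})"
    using sum_bounded_below[of "I - {u0}" d c] u0 assms(3)[of u0] by (force simp: d_def)
  then have "c u0 + (card I - 1) * d \<le> sum c I"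
    using u0 assms(1) by (simp add: sum.remove[of I u0])
  then show thesis using that[of "c u0" d] u0 by (auto simp: d_def)
qed

text \<open>The situation of a failed induction step: \<open>W\<close> will be the
  \<open>Y\<close>-part of a cycle through all but one vertex of \<open>A\<close>. The cycles
  excluded by \<open>no_cycle\<close> stay inside \<open>A \<union> Y\<close>, since a cycle for
  \<open>A\<close> has to avoid the rest of \<open>X\<close>.\<close>

locale critical_bigraph = bigraph +
  fixes W :: "'a set" and \<delta> :: nat
  assumes W_subset: "W \<subseteq> Y"
    and card_W: "card A = Suc (card W)"
    and card_A: "card A \<ge> 4"
    and delta: "card A \<le> \<delta>"
    and card_Y: "card Y + 5 \<le> 3 * \<delta>"
    and degree_A: "u \<in> A \<Longrightarrow> \<delta> \<le> degree E u"
    and no_cycle: "is_cycle E C \<Longrightarrow> A \<subseteq> set C \<Longrightarrow> set C \<subseteq> A \<union> Y \<Longrightarrow> False"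
begin

lemma finite_W: "finite W"
  using W_subset finite_Y finite_subset by auto

lemma finite_outside: "finite (outside W u)"
  unfolding outside_def using finite_Y by auto

lemma card_neighbours_W: "missing W u + card {y \<in> W. E u y} = card W"
proof -
  have "card ({y \<in> W. \<not> E u y} \<union> {y \<in> W. E u y}) = missing W u + card {y \<in> W. E u y}"
    unfolding missing_def by (rule card_Un_disjoint) (use finite_W in auto)
  moreover have "{y \<in> W. \<not> E u y} \<union> {y \<in> W. E u y} = W" by auto
  ultimately show ?thesis by simp
qed

text \<open>The vertex \<open>u\<close> has \<open>card W - missing W u\<close> neighbours in
  \<open>W\<close>, and \<open>card W = card A - 1\<close>; the other neighbours lie
  outside.\<close>

lemma card_outside:
  assumes "u \<in> A"
  shows "\<delta> + 1 + missing W u \<le> card (outside W u) + card A"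
proof -
  have "{y. E u y} = outside W u \<union> {y \<in> W. E u y}"
    using bip[of u] assms disjoint W_subset unfolding outside_def by blast
  then have "degree E u = card (outside W u \<union> {y \<in> W. E u y})" unfolding degree_def by simp
  also have "\<dots> \<le> card (outside W u) + card {y \<in> W. E u y}" by (rule card_Un_le)
  finally show ?thesis using card_neighbours_W[of u] degree_A[OF assms] card_W by linarith
qed

text \<open>A common neighbour outside \<open>W\<close> would close a spanning path from
  \<open>u\<close> to \<open>v\<close> into a cycle covering \<open>A\<close>.\<close>

lemma joined_disjoint:
  assumes "joined W u v" "u \<in> A" "v \<in> A"
  shows "outside W u \<inter> outside W v = {}"
proof (rule ccontr)
  assume "outside W u \<inter> outside W v \<noteq> {}"
  then obtain y where y: "y \<in> Y" "y \<notin> W" "E u y" "E v y" unfolding outside_def by auto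
  obtain P where P: "ham W P" "hd P = u" "last P = v" using assms unfolding joined_def by auto
  have d: "P \<noteq> []" "distinct P" "successively E P" "set P = A \<union> W" using P(1) unfolding ham_def by auto
  have "card A \<le> length P"
    using card_mono[of "set P" A] card_length[of P] d finite_A finite_W by auto
  then have "is_cycle E (y # P)"
    using d P y card_A disjoint by (intro is_cycleI) (auto simp: successively_Cons intro: sym)
  then show False using no_cycle[of "y # P"] d y W_subset by auto
qed

lemma good_subset: "good W I \<Longrightarrow> I \<subseteq> A"
  unfolding good_def by auto

lemma good_finite: "good W I \<Longrightarrow> finite I"
  using good_subset finite_A finite_subset by metis

lemma card_Union_outside:
  assumes "good W I"
  shows "card (\<Union>u\<in>I. outside W u) = (\<Sum>u\<in>I. card (outside W u))"
  using assms good_finite[OF assms] joined_disjoint finite_outside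
  by (intro card_UN_disjoint) (auto simp: good_def subset_iff)

lemma card_outside_total: "card (Y - W) + card A = card Y + 1"
  using card_Diff_subset[OF finite_W W_subset] card_mono[OF finite_Y W_subset] card_W by linarith

lemma sum_outside_le:
  assumes "good W I"
  shows "(\<Sum>u\<in>I. card (outside W u)) + card A \<le> card Y + 1"
proof -
  have "card (\<Union>u\<in>I. outside W u) \<le> card (Y - W)"
    using finite_Y by (intro card_mono) (auto simp: outside_def)
  then show ?thesis using card_Union_outside[OF assms] card_outside_total by linarith
qed

lemma good_weight:
  assumes "good W I"
  shows "card I * (\<delta> - card A + 1) + (\<Sum>u\<in>I. missing W u) \<le> (\<Sum>u\<in>I. card (outside W u))"
proof -
  have "(\<Sum>u\<in>I. (\<delta> - card A + 1) + missing W u) \<le> (\<Sum>u\<in>I. card (outside W u))"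
    using card_outside good_subset[OF assms] delta by (intro sum_mono) (smt (verit) add.commute add.left_commute add_le_cancel_left le_add_diff_inverse subsetD)
  then show ?thesis unfolding sum.distrib by simp
qed

text \<open>With \<open>n = card A\<close> and \<open>\<delta> = n + e\<close>, the set
  \<open>Y - W\<close> has at most \<open>2 * n + 3 * e - 4\<close> elements. The disjoint outside
  neighbourhoods each take at least \<open>e + 1\<close> of them plus the number of missing edges,
  and three or more members absorb the term \<open>3 * e\<close>.\<close>

lemma good_missing:
  assumes "good W I" "card I \<ge> 3"
  shows "card I + (\<Sum>u\<in>I. missing W u) + 4 \<le> 2 * card A"
proof -
  define e where "e = \<delta> - card A"
  have d: "\<delta> = card A + e" using delta by (simp add: e_def)
  have "3 * e \<le> card I * e" using assms(2) by (rule mult_le_mono1)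
  moreover have "card I * (\<delta> - card A + 1) = card I * e + card I" by (simp add: e_def)
  ultimately show ?thesis
    using good_weight[OF assms(1)] sum_outside_le[OF assms(1)] card_Y d by linarith
qed

text \<open>Here \<open>Z\<close> stands for the predecessors on the cycle of the neighbours of
  \<open>x\<close>, so the equation says that \<open>x\<close> has \<open>card Z\<close> neighbours
  in \<open>W\<close>. A maximum good set \<open>I\<close> is compared with
  \<open>insert x Z\<close> and the good sets from \<open>pairs\<close>. The counts force
  \<open>\<kappa> = 2\<close>, then make each member of \<open>I\<close> miss exactly one vertex of
  \<open>W\<close>, which leaves too little room for the neighbours of \<open>x\<close> outside
  \<open>W\<close>.\<close>

lemma critical_contradiction:
  assumes not_good: "\<not> good W A"
    and x: "x \<notin> Z" "good W (insert x Z)" "missing W x + card Z + 1 = card A" "card Z \<ge> 2"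
    and pairs: "\<And>u v. u \<in> Z \<Longrightarrow> v \<in> Z \<Longrightarrow> u \<noteq> v \<Longrightarrow>
      \<exists>I. good W I \<and> x \<in> I \<and> card A \<le> card I + missing W u + missing W v"
  shows False
proof -
  define n where "n = card A"
  have finZ: "finite Z" using good_finite[OF x(2)] by auto
  obtain I where I: "good W I" "\<And>I'. good W I' \<Longrightarrow> card I' \<le> card I"
  proof -
    have "\<exists>I. good W I \<and> (\<forall>I'. good W I' \<longrightarrow> card I' \<le> card I)"
    proof (rule ex_has_greatest_nat)
      show "good W (insert x Z)" by (rule x(2))
      show "\<forall>I. good W I \<longrightarrow> card I < Suc (card A)"
        using card_mono[OF finite_A good_subset] by (simp add: less_Suc_eq_le)
    qed
    then show thesis using that by blast
  qed
  have IA: "I \<subseteq> A" "finite I" using I good_subset good_finite by auto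
  have "I \<noteq> A" using I(1) not_good by auto
  then have "card I < n" using IA finite_A unfolding n_def by (simp add: psubset_card_mono psubsetI)
  define \<kappa> where "\<kappa> = n - card I"
  have \<kappa>: "card I + \<kappa> = n" "\<kappa> \<ge> 1" using \<open>card I < n\<close> unfolding \<kappa>_def by auto
  have pair_sum: "\<kappa> \<le> missing W u + missing W v" if uv: "u \<in> A" "v \<in> A" "joined W u v" for u v
  proof -
    obtain I' where "good W I'" "card A \<le> card I' + missing W u + missing W v"
      using joined_good[OF uv(3,1,2) W_subset] .
    then show ?thesis using I(2)[of I'] \<kappa>(1) n_def by linarith
  qed
  have J_le: "card Z + 1 \<le> card I" using I(2)[OF x(2)] x(1) finZ by simp
  \<comment> \<open>In the bound \<open>2 * n\<close> for \<open>insert x Z\<close>, the terms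
    \<open>missing W x\<close> and \<open>card Z + 1\<close> already use up
    \<open>n\<close>.\<close>
  have sumZ: "(\<Sum>u\<in>Z. missing W u) + 4 \<le> n"
    using good_missing[OF x(2)] x finZ unfolding n_def by simp
  have pairZ: "missing W u + missing W v + 4 \<le> n" if "u \<in> Z" "v \<in> Z" "u \<noteq> v" for u v
  proof -
    have "(\<Sum>u\<in>{u,v}. missing W u) \<le> (\<Sum>u\<in>Z. missing W u)"
      using that finZ by (intro sum_mono2) auto
    then show ?thesis using sumZ that by simp
  qed
  obtain u0 v0 where uv: "u0 \<in> Z" "v0 \<in> Z" "u0 \<noteq> v0"
    using x(4) by (metis card_le_Suc0_iff_eq finZ not_less_eq_eq numeral_2_eq_2)
  obtain I0 where I0: "good W I0" "x \<in> I0" "n \<le> card I0 + missing W u0 + missing W v0"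
    using pairs[OF uv] n_def by auto
  have I0_4: "card I0 \<ge> 4" using I0(3) pairZ[OF uv] by linarith
  have good_pair: "\<kappa> \<le> missing W u + missing W v" if "good W K" "u \<in> K" "v \<in> K" "u \<noteq> v" for K u v
    using that pair_sum[of u v] unfolding good_def by auto
  have low: "\<exists>a d. a \<le> d \<and> \<kappa> \<le> a + d \<and> a + (card K - 1) * d \<le> (\<Sum>u\<in>K. missing W u) \<and> (\<forall>u\<in>K. a \<le> missing W u)"
    if "good W K" "K \<noteq> {}" for K
    using sum_pairwise_lower[of K \<kappa> "missing W"] good_finite[OF that(1)] that good_pair[OF that(1)] by metis
  have I4: "card I \<ge> 4" using I(2)[OF I0(1)] I0_4 by linarith
  have mI: "card I + (\<Sum>u\<in>I. missing W u) + 4 \<le> 2 * n"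
    using good_missing[OF I(1)] I4 n_def by auto
  \<comment> \<open>For \<open>\<kappa> = 1\<close> all but one member of \<open>I\<close> miss a
    vertex, while \<open>mI\<close> allows only \<open>card I - 2\<close> missing edges.\<close>
  have "\<kappa> \<noteq> 1"
  proof
    assume k1: "\<kappa> = 1"
    obtain a d where "a \<le> d" "\<kappa> \<le> a + d" "a + (card I - 1) * d \<le> (\<Sum>u\<in>I. missing W u)"
      using low[OF I(1)] I4 by force
    moreover have "(card I - 1) * 1 \<le> (card I - 1) * d" using calculation k1 by (intro mult_le_mono2) auto
    ultimately show False using mI k1 \<kappa> by linarith
  qed
  \<comment> \<open>Twice \<open>a + (r + 1) * d\<close> is
    \<open>2 * (a + d) + r * (2 * d)\<close>, where \<open>a + d\<close> and, by
    \<open>a \<le> d\<close>, also \<open>2 * d\<close> are at least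
    \<open>\<kappa>\<close>.\<close>
  have twice: "card K * \<kappa> \<le> 2 * (\<Sum>u\<in>K. missing W u)" if K: "good W K" "K \<noteq> {}" "card K \<ge> 2" for K
  proof -
    obtain a d where ad: "a \<le> d" "\<kappa> \<le> a + d" "a + (card K - 1) * d \<le> (\<Sum>u\<in>K. missing W u)"
      using low[OF K(1,2)] by auto
    obtain r where r: "card K = r + 2" using K(3) by (metis add.commute le_Suc_ex)
    have "r * \<kappa> \<le> r * (2 * d)" using ad by (intro mult_le_mono2) auto
    moreover have "r * (2 * d) = 2 * (r * d)" "card K * \<kappa> = r * \<kappa> + 2 * \<kappa>" "(card K - 1) * d = r * d + d"
      unfolding r by (simp_all add: algebra_simps)
    ultimately show ?thesis using ad by linarith
  qed
  \<comment> \<open>With \<open>n = card I + \<kappa>\<close> the factor \<open>n - 4 - \<kappa>\<close> becomes \<open>card I - 4\<close>.\<close>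
  have quad: "\<kappa> = 2 \<or> card I = 4"
  proof -
    have "card I * \<kappa> + 2 * card I + 8 \<le> 4 * n"
      using twice[OF I(1)] I4 mI by fastforce
    then have "card I * \<kappa> + 8 \<le> 2 * card I + 4 * \<kappa>" using \<kappa>(1) by linarith
    then have *: "(int (card I) - 4) * (int \<kappa> - 2) \<le> 0"
      by (simp add: algebra_simps flip: of_nat_mult)
    show ?thesis
    proof (rule ccontr)
      assume "\<not> ?thesis"
      then have "int (card I) - 4 > 0" "int \<kappa> - 2 > 0" using I4 \<open>\<kappa> \<noteq> 1\<close> \<kappa>(2) by auto
      then show False using * by (smt (verit) mult_pos_pos)
    qed
  qed
  \<comment> \<open>If \<open>card I = 4\<close>, then \<open>I0\<close> is a maximum good set too,
    and it contains \<open>x\<close>, which misses at least \<open>\<kappa>\<close> vertices. The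
    other three miss at least \<open>3 * \<kappa> / 2\<close> together, but the total is at most
    \<open>2 * \<kappa>\<close>.\<close>
  have card4: "card I \<noteq> 4"
  proof
    assume "card I = 4"
    then have c4: "card I0 = 4" "n = \<kappa> + 4" using I0_4 I(2)[OF I0(1)] \<kappa> by auto
    have "card Z \<le> 3" using J_le \<open>card I = 4\<close> by auto
    then have mx: "\<kappa> \<le> missing W x" using x(3) c4 n_def by linarith
    have f: "finite I0" using good_finite[OF I0(1)] .
    have "good W (I0 - {x})" using I0(1) unfolding good_def by auto
    moreover have "card (I0 - {x}) = 3" using c4 I0(2) f by simp
    ultimately have "3 * \<kappa> \<le> 2 * (\<Sum>u\<in>I0 - {x}. missing W u)" using twice[of "I0 - {x}"] by fastforce
    moreover have "(\<Sum>u\<in>I0. missing W u) = missing W x + (\<Sum>u\<in>I0 - {x}. missing W u)"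
      using f I0(2) by (simp add: sum.remove)
    moreover have "card I0 + (\<Sum>u\<in>I0. missing W u) + 4 \<le> 2 * n" using good_missing[OF I0(1)] c4 n_def by auto
    ultimately show False using mx c4 \<kappa>(2) by linarith
  qed
  then have k2: "\<kappa> = 2" using quad by auto
  then have n: "n = card I + 2" "card I \<ge> 5" using card4 I4 \<kappa> by auto
  \<comment> \<open>At most \<open>card K\<close> edges are missing in total. Were the minimum
    \<open>a\<close> zero, all other members would miss at least two vertices, which is too many; so
    each misses at least one and hence exactly one.\<close>
  have all_one: "missing W u = 1" if K: "good W K" "card K = card I" "u \<in> K" for K u
  proof -
    have fK: "finite K" using good_finite[OF K(1)] .
    have s: "(\<Sum>u\<in>K. missing W u) \<le> card K" using good_missing[OF K(1)] K(2) n n_def by auto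
    obtain a d where ad: "a \<le> d" "\<kappa> \<le> a + d" "a + (card K - 1) * d \<le> (\<Sum>u\<in>K. missing W u)" "\<And>u. u \<in> K \<Longrightarrow> a \<le> missing W u"
      using low[OF K(1)] K(3) by blast
    have "a \<noteq> 0"
    proof
      assume "a = 0"
      then have "(card K - 1) * 2 \<le> (card K - 1) * d" using ad k2 by (intro mult_le_mono2) auto
      then show False using \<open>a = 0\<close> ad(3) s K(2) n by linarith
    qed
    then have ge: "\<And>u. u \<in> K \<Longrightarrow> 1 \<le> missing W u" using ad(4) by force
    have "(\<Sum>u\<in>K - {u}. 1) \<le> (\<Sum>u\<in>K - {u}. missing W u)" using ge by (intro sum_mono) auto
    then have "missing W u \<le> 1" using s fK K(3) by (simp add: sum.remove[of K u])
    then show ?thesis using ge[OF K(3)] by simp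
  qed
  have mx2: "missing W x \<ge> 2" using x(3) J_le n n_def by linarith
  have xI: "x \<notin> I" using all_one[OF I(1)] mx2 by force
  \<comment> \<open>A pair in \<open>Z \<inter> I\<close> would yield another maximum good set, but one containing \<open>x\<close>.\<close>
  have "\<not> (u \<in> Z \<inter> I \<and> v \<in> Z \<inter> I \<and> u \<noteq> v)" for u v
  proof
    assume a: "u \<in> Z \<inter> I \<and> v \<in> Z \<inter> I \<and> u \<noteq> v"
    then obtain K where K: "good W K" "x \<in> K" "n \<le> card K + missing W u + missing W v"
      using pairs[of u v] n_def by auto
    have "card K = card I" using K(3) I(2)[OF K(1)] all_one[OF I(1)] a n by fastforce
    then show False using all_one[OF K(1) _ K(2)] mx2 by simp
  qed
  then have "card (Z \<inter> I) \<le> 1" using finZ by (metis One_nat_def card_le_Suc0_iff_eq finite_Int)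
  \<comment> \<open>The set \<open>A - I\<close> has two elements, and \<open>x\<close> is one of
    them.\<close>
  moreover have "card (Z - I) \<le> 1"
  proof -
    have ZA: "insert x Z \<subseteq> A" using good_subset[OF x(2)] .
    have "card (insert x (Z - I) \<union> I) \<le> n" unfolding n_def using ZA IA finite_A by (intro card_mono) auto
    moreover have "card (insert x (Z - I) \<union> I) = card (insert x (Z - I)) + card I"
      using IA finZ xI by (intro card_Un_disjoint) auto
    moreover have "card (insert x (Z - I)) = card (Z - I) + 1" using x(1) finZ by simp
    ultimately show ?thesis using n by linarith
  qed
  moreover have "card Z = card (Z \<inter> I) + card (Z - I)"
    using card_Int_Diff[OF finZ] .
  ultimately have Z2: "card Z = 2" "card (Z \<inter> I) = 1" using x(4) by linarith+
  then obtain u where u: "u \<in> Z" "u \<in> I" by (metis Int_iff card_eq_0_iff ex_in_conv zero_neq_one)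
  have mu: "missing W u = 1" using all_one[OF I(1)] u by auto
  have xA: "x \<in> A" "u \<in> A" using good_subset[OF x(2)] u by auto
  have xu: "joined W x u" using x(1,2) u unfolding good_def by auto
  have sumI: "(\<Sum>u\<in>I. missing W u) = card I" using all_one[OF I(1)] by simp
  define e where "e = \<delta> - n"
  have de: "\<delta> = n + e" using delta by (simp add: e_def n_def)
  have gw: "card I * (e + 1) + card I \<le> (\<Sum>u\<in>I. card (outside W u))"
    using good_weight[OF I(1)] sumI by (simp add: e_def n_def)
  have so: "(\<Sum>u\<in>I. card (outside W u)) + 4 \<le> 2 * n + 3 * e"
    using sum_outside_le[OF I(1)] card_Y de n_def by linarith
  \<comment> \<open>\<open>gw\<close> and \<open>so\<close> combine to
    \<open>card I * e \<le> 3 * e\<close>, while \<open>card I \<ge> 5\<close>.\<close>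
  have "e = 0"
  proof (rule ccontr)
    assume "e \<noteq> 0"
    have "5 * e \<le> card I * e" using n(2) by (rule mult_le_mono1)
    moreover have "card I * (e + 1) = card I * e + card I" by simp
    ultimately show False using gw so n \<open>e \<noteq> 0\<close> by linarith
  qed
  then have out_sum: "(\<Sum>u\<in>I. card (outside W u)) = 2 * card I" using gw so n by simp
  have out_ge: "2 \<le> card (outside W w)" if "w \<in> I" for w
    using card_outside[of w] that IA all_one[OF I(1) _ that] de \<open>e = 0\<close> n_def by auto
  have out_2: "card (outside W w) \<le> 2" if w: "w \<in> I" for w
  proof -
    have "(\<Sum>u\<in>I - {w}. 2) \<le> (\<Sum>u\<in>I - {w}. card (outside W u))" using out_ge by (intro sum_mono) auto
    then show ?thesis using out_sum IA(2) w n(2) by (simp add: sum.remove[of I w])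
  qed
  \<comment> \<open>The outside neighbours of \<open>I\<close> exhaust \<open>Y - W\<close>, so
    every outside neighbour of \<open>x\<close> is shared with a member of \<open>I\<close>.\<close>
  have cover: "(\<Union>w\<in>I. outside W w) = Y - W"
  proof (rule card_subset_eq)
    have "card (Y - W) \<le> 2 * card I" using card_outside_total card_Y de \<open>e = 0\<close> n n_def by linarith
    moreover have "card (\<Union>w\<in>I. outside W w) \<le> card (Y - W)"
      using finite_Y by (intro card_mono) (auto simp: outside_def)
    ultimately show "card (\<Union>w\<in>I. outside W w) = card (Y - W)"
      using card_Union_outside[OF I(1)] out_sum by linarith
  qed (auto simp: outside_def finite_Y)
  define N where "N = {w \<in> I. outside W x \<inter> outside W w \<noteq> {}}"
  \<comment> \<open>Members of \<open>N\<close> are not joined to \<open>x\<close>. Since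
    \<open>u\<close> is joined to \<open>x\<close> and misses only one vertex, there is at most one
    of them.\<close>
  have "card N \<le> 1"
  proof -
    have "N \<subseteq> {w \<in> A. w \<noteq> x \<and> \<not> joined W x w}"
      using joined_disjoint[of x] xA IA xI unfolding N_def by blast
    then have "card N \<le> card {w \<in> A. w \<noteq> x \<and> \<not> joined W x w}" using finite_A by (intro card_mono) auto
    then show ?thesis using card_not_joined[OF xu W_subset] mu by linarith
  qed
  have "outside W x \<subseteq> (\<Union>w\<in>N. outside W w)"
    using cover unfolding N_def outside_def by blast
  then have "card (outside W x) \<le> card (\<Union>w\<in>N. outside W w)"
    using IA(2) finite_outside by (intro card_mono) (auto simp: N_def)
  also have "\<dots> \<le> (\<Sum>w\<in>N. card (outside W w))" using IA(2) by (intro card_UN_le) (simp add: N_def)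
  also have "\<dots> \<le> card N * 2" using sum_bounded_above[of N "\<lambda>w. card (outside W w)" 2] out_2 unfolding N_def by auto
  finally have "card (outside W x) \<le> 2" using \<open>card N \<le> 1\<close> by linarith
  \<comment> \<open>As \<open>x\<close> misses \<open>n - 3\<close> vertices of \<open>W\<close>, it
    has at least \<open>n - 2 \<ge> 5\<close> outside neighbours.\<close>
  moreover have "n + 1 + missing W x \<le> card (outside W x) + n" using card_outside[OF xA(1)] de \<open>e = 0\<close> n_def by simp
  ultimately show False using x(3) Z2 n n_def by linarith
qed

end

section \<open>Predecessors on the cycle of the neighbours of \<open>x\<close>\<close>

context critical_bigraph
begin

text \<open>The cycle is cut before \<open>y\<close> and before \<open>y'\<close> and rejoined
  through \<open>x\<close>, so the ends are the predecessors of \<open>y\<close> and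
  \<open>y'\<close>. The path neighbours of \<open>x\<close> are \<open>y\<close> and
  \<open>y'\<close>, each adjacent to the end that matters, so \<open>x\<close> is blocked from
  neither side.\<close>

lemma path_through_x:
  assumes C: "distinct C" "successively E C" "E (last C) (hd C)" "set C = (A - {x}) \<union> W"
    and x: "x \<in> A"
    and split: "C = B @ y # D @ y' # F" and B: "B \<noteq> []" and xy: "E x y" "E x y'"
  shows "D \<noteq> []"
    and "\<exists>P. ham W P \<and> hd P = last B \<and> last P = last D \<and> x \<notin> blocked P \<and> x \<notin> blocked (rev P)"
proof -
  have yY: "y \<in> Y" "y' \<in> Y" using bip[of x] xy x disjoint by auto
  have sC: "successively E (B @ y # D @ y' # F)" using C(2) split by simp
  have dC: "distinct (B @ y # D @ y' # F)" using C(1) split by simp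
  show Dn: "D \<noteq> []"
  proof
    assume "D = []"
    then have "E y y'" using sC by (auto simp: successively_append_iff)
    then show False using bip yY by auto
  qed
  define P where "P = rev B @ rev F @ y' # x # y # D"
  have "x \<notin> set C" using C(4) x W_subset disjoint by auto
  then have d: "distinct P" using dC unfolding P_def split by auto
  have hl: "E (last (y' # F)) (hd B)" using C(3) B unfolding split by (simp add: hd_append)
  have s: "successively E P"
    unfolding P_def using sC B Dn xy hl
    by (cases "F = []") (auto simp: successively_append_iff successively_Cons successively_rev_E hd_rev last_rev simp del: successively_rev intro: sym)
  have "set P = insert x (set C)" unfolding P_def split by auto
  then have h: "ham W P" unfolding ham_def using d s x C(4) by (auto simp: P_def)
  have ends: "hd P = last B" "last P = last D" unfolding P_def using B Dn by (auto simp: hd_append hd_rev)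
  have e: "E (last B) y" "E (last D) y'" using sC B Dn by (auto simp: successively_append_iff successively_Cons)
  have "x \<notin> blocked P"
  proof
    assume "x \<in> blocked P"
    then obtain F1 z G1 where 1: "P = F1 @ x # z # G1" "\<not> E (hd P) z" unfolding blocked_def by blast
    have "(rev B @ rev F @ [y']) @ x # (y # D) = F1 @ x # (z # G1)" using 1 unfolding P_def by simp
    moreover have "x \<notin> set (rev B @ rev F @ [y'])" "x \<notin> set (y # D)" using d unfolding P_def by auto
    ultimately have "y = z" using append_Cons_eq_iff by (metis list.inject)
    then show False using 1 e ends by auto
  qed
  moreover have "x \<notin> blocked (rev P)"
  proof
    assume "x \<in> blocked (rev P)"
    then obtain F1 z G1 where 1: "rev P = F1 @ x # z # G1" "\<not> E (hd (rev P)) z" unfolding blocked_def by blast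
    have "(rev D @ [y]) @ x # (y' # F @ B) = F1 @ x # (z # G1)" using 1 unfolding P_def by simp
    moreover have "x \<notin> set (rev D @ [y])" "x \<notin> set (y' # F @ B)" using d unfolding P_def by auto
    ultimately have "y' = z" using append_Cons_eq_iff by (metis list.inject)
    then show False using 1(2) e ends by (simp add: hd_rev)
  qed
  ultimately show "\<exists>P. ham W P \<and> hd P = last B \<and> last P = last D \<and> x \<notin> blocked P \<and> x \<notin> blocked (rev P)"
    using h ends by blast
qed

text \<open>Provides the set \<open>Z\<close> for \<open>critical_contradiction\<close>. Starting
  the list in \<open>A\<close> gives every vertex of \<open>W\<close> a predecessor in it;
  \<open>triple\<close> serves to show that \<open>x\<close> has two neighbours on the
  cycle.\<close>

lemma cycle_contradiction:
  assumes C: "distinct C" "successively E C" "E (last C) (hd C)" "set C = (A - {x}) \<union> W"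
    and hdC: "C \<noteq> []" "hd C \<in> A"
    and x: "x \<in> A"
    and not_good: "\<not> good W A"
    and triple: "\<And>p q. p \<in> A \<Longrightarrow> q \<in> A \<Longrightarrow> p \<noteq> q \<Longrightarrow> p \<noteq> x \<Longrightarrow> q \<noteq> x \<Longrightarrow>
      \<exists>a b. a \<noteq> b \<and> E x a \<and> E p a \<and> E x b \<and> E q b"
  shows False
proof -
  have xC: "x \<notin> set C" using C(4) x W_subset disjoint by auto
  define pred where "pred y = last (takeWhile (\<lambda>z. z \<noteq> y) C)" for y
  have pred: "pred y = last B" "B \<noteq> []" "last B \<in> A" "E (last B) y" if "C = B @ y # D" "y \<in> W" for B y D
  proof -
    have "takeWhile (\<lambda>z. z \<noteq> y) C = B" using C(1) unfolding that(1) by (auto simp: takeWhile_append)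
    then show "pred y = last B" unfolding pred_def by simp
    show B: "B \<noteq> []" using hdC that W_subset disjoint by auto
    show e: "E (last B) y" using C(2) B unfolding that(1) by (auto simp: successively_append_iff)
    have "last B \<in> set C" using B that(1) by auto
    then show "last B \<in> A" using C(4) bip[OF e] that(2) W_subset by auto
  qed
  have split: "\<exists>B D. C = B @ y # D" if "y \<in> W" for y
    using that C(4) split_list[of y C] by auto
  define S where "S = {y \<in> W. E x y}"
  define Z where "Z = pred ` S"
  have split2: "\<exists>B D F. C = B @ y # D @ y' # F \<or> C = B @ y' # D @ y # F" if y: "y \<in> W" "y' \<in> W" "y \<noteq> y'" for y y'
  proof -
    obtain B D where BD: "C = B @ y # D" using split[OF y(1)] by blast
    have "y' \<in> set C" using y C(4) by auto
    then consider "y' \<in> set B" | "y' \<in> set D" using BD y(3) by auto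
    then show ?thesis
    proof cases
      case 1
      then obtain B1 B2 where "B = B1 @ y' # B2" by (meson split_list)
      then have "C = B1 @ y' # B2 @ y # D" using BD by simp
      then show ?thesis by blast
    next
      case 2
      then obtain D1 D2 where "D = D1 @ y' # D2" by (meson split_list)
      then show ?thesis using BD by blast
    qed
  qed
  have ordered: "last B \<noteq> last D \<and> last D \<in> A \<and> pred y = last B \<and> pred y' = last D \<and>
      (\<exists>P. ham W P \<and> hd P = last B \<and> last P = last D \<and> x \<notin> blocked P \<and> x \<notin> blocked (rev P))"
    if "C = B @ y # D @ y' # F" "y \<in> S" "y' \<in> S" for B y D y' F
  proof -
    have p: "pred y = last B" "B \<noteq> []" using pred[of B y] that unfolding S_def by auto
    have D: "D \<noteq> []" and ex: "\<exists>P. ham W P \<and> hd P = last B \<and> last P = last D \<and> x \<notin> blocked P \<and> x \<notin> blocked (rev P)"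
      using path_through_x[OF C x that(1) p(2)] that unfolding S_def by auto
    have "C = (B @ y # D) @ y' # F" using that(1) by simp
    then have "pred y' = last (B @ y # D)" "last (B @ y # D) \<in> A"
      using pred[of "B @ y # D" y' F] that(3) unfolding S_def by auto
    moreover have "last B \<noteq> last D"
      using C(1) last_in_set[OF p(2)] last_in_set[OF D] unfolding that(1) by auto
    ultimately show ?thesis using p ex D by auto
  qed
  have finS: "finite S" unfolding S_def using finite_W by auto
  have inj: "inj_on pred S"
  proof (rule inj_onI, rule ccontr)
    fix y y' assume y: "y \<in> S" "y' \<in> S" "pred y = pred y'" "y \<noteq> y'"
    obtain B D F where "C = B @ y # D @ y' # F \<or> C = B @ y' # D @ y # F"
      using split2[of y y'] y unfolding S_def by blast
    then show False using ordered[of B y D y' F] ordered[of B y' D y F] y by auto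
  qed
  have cardZ: "card Z = card S" unfolding Z_def using inj by (rule card_image)
  have ZA: "Z \<subseteq> A - {x}"
  proof
    fix z assume "z \<in> Z"
    then obtain y where y: "z = pred y" "y \<in> S" unfolding Z_def by auto
    then obtain B D where BD: "C = B @ y # D" using split unfolding S_def by blast
    then have "z = last B" "B \<noteq> []" "z \<in> A" using pred[OF BD] y unfolding S_def by auto
    then show "z \<in> A - {x}" using BD xC by auto
  qed
  have path: "\<exists>P. ham W P \<and> ((hd P = u \<and> last P = v) \<or> (hd P = v \<and> last P = u)) \<and> x \<notin> blocked P \<and> x \<notin> blocked (rev P)"
    if uv: "u \<in> Z" "v \<in> Z" "u \<noteq> v" for u v
  proof -
    obtain y y' where y: "u = pred y" "v = pred y'" "y \<in> S" "y' \<in> S" using uv unfolding Z_def by auto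
    obtain B D F where "C = B @ y # D @ y' # F \<or> C = B @ y' # D @ y # F"
      using split2[of y y'] y uv(3) unfolding S_def by blast
    then show ?thesis using ordered[of B y D y' F] ordered[of B y' D y F] y by metis
  qed
  \<comment> \<open>Cutting the cycle before \<open>y\<close> and putting \<open>x\<close> in front
    gives a path once around to the predecessor of \<open>y\<close>.\<close>
  have jx: "joined W x u" if uZ: "u \<in> Z" for u
  proof -
    obtain y where y: "u = pred y" "y \<in> S" using uZ unfolding Z_def by auto
    then obtain B D where BD: "C = B @ y # D" using split unfolding S_def by blast
    have yS: "y \<in> W" "E x y" using y unfolding S_def by auto
    have p: "u = last B" "B \<noteq> []" using pred[OF BD yS(1)] y by auto
    have "E (last (y # D)) (hd B)" using C(3) p BD by (simp add: hd_append)
    then have "successively E (x # y # D @ B)"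
      using C(2) yS p unfolding BD by (cases "D = []") (auto simp: successively_append_iff successively_Cons)
    moreover have "distinct (x # y # D @ B)" using C(1) xC unfolding BD by auto
    moreover have "set (x # y # D @ B) = insert x (set C)" unfolding BD by auto
    ultimately have "ham W (x # y # D @ B)" unfolding ham_def using C(4) x by auto
    then show ?thesis unfolding joined_def using p by (metis append_Cons last_append list.sel(1))
  qed
  have S2: "card S \<ge> 2"
  proof (rule ccontr)
    assume "\<not> card S \<ge> 2"
    then have S1: "card S \<le> 1" by simp
    have Wn: "W \<noteq> {}" using card_W card_A by auto
    \<comment> \<open>If \<open>S\<close> is empty, any vertex of \<open>W\<close> serves as
      \<open>y\<close>. Deleting \<open>y\<close> from the cycle leaves a path \<open>R\<close>
      without neighbours of \<open>x\<close>.\<close>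
    obtain y where y: "y \<in> W" "S \<subseteq> {y}"
    proof (cases "S = {}")
      case True
      then show thesis using Wn that by auto
    next
      case False
      then obtain y where "y \<in> S" by auto
      moreover have "S \<subseteq> {y}" using calculation S1 finS by (metis One_nat_def card_le_Suc0_iff_eq insertI1 subsetI)
      ultimately show thesis using that unfolding S_def by auto
    qed
    obtain B D where BD: "C = B @ y # D" using split[OF y(1)] by blast
    have p: "B \<noteq> []" "last B \<in> A" using pred[OF BD y(1)] by auto
    define R where "R = D @ B"
    have hl: "E (last (y # D)) (hd B)" using C(3) p BD by (simp add: hd_append)
    have R: "successively E R" "distinct R" "set R = set C - {y}" "R \<noteq> []" "last R = last B"
      using C(1,2) hl p unfolding BD R_def by (auto simp: successively_append_iff successively_Cons split: if_splits)
    have "hd R \<in> A"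
    proof (cases D)
      case Nil
      then show ?thesis using hdC p BD unfolding R_def by simp
    next
      case (Cons d D')
      then have "E y d" using C(2) unfolding BD by (auto simp: successively_append_iff)
      then have "d \<notin> Y" using bip y(1) W_subset by auto
      moreover have "d \<in> set C" using BD Cons by auto
      ultimately show ?thesis using C(4) W_subset Cons unfolding R_def by auto
    qed
    moreover have "hd R \<noteq> last R"
    proof
      assume "hd R = last R"
      then have "length R \<le> 1"
        using R(2,4) by (cases R) (auto split: if_splits)
      moreover have "card (A - {x}) \<le> card (set R)"
        using C(4) R(3) y(1) W_subset disjoint finite_A finite_W by (intro card_mono) auto
      moreover have "card (A - {x}) \<ge> 3" using x card_A finite_A by simp
      ultimately show False using card_length[of R] by linarith
    qed
    moreover have "hd R \<noteq> x" "last R \<noteq> x" using R(3,4) xC hd_in_set[of R] last_in_set[of R] by auto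
    \<comment> \<open>Both \<open>a\<close> and \<open>b\<close> lie off \<open>R\<close>, though
      one of them may be \<open>y\<close>, so \<open>a\<close>, \<open>x\<close>, \<open>b\<close>
      close \<open>R\<close> into a cycle covering \<open>A\<close>.\<close>
    ultimately obtain a b where ab: "a \<noteq> b" "E x a" "E (last R) a" "E x b" "E (hd R) b"
      using triple[of "last R" "hd R"] p(2) R(5) by metis
    have abY: "a \<in> Y" "b \<in> Y" using ab bip[of x] x disjoint by auto
    have "a \<notin> set R" "b \<notin> set R"
      using R(3) C(4) y(2) ab abY disjoint unfolding S_def by auto
    then have "distinct (R @ [a, x, b])" using R(2,3) xC ab(1) abY x disjoint by auto
    moreover have "successively E (R @ [a, x, b])"
      using R(1) ab by (auto simp: successively_append_iff intro: sym)
    ultimately have "is_cycle E (R @ [a, x, b])"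
      using ab R(4) by (intro is_cycleI) (auto intro: sym)
    moreover have "A \<subseteq> set (R @ [a, x, b])" using R(3) C(4) y(1) W_subset disjoint by auto
    moreover have "set (R @ [a, x, b]) \<subseteq> A \<union> Y" using R(3) C(4) W_subset abY x by auto
    ultimately show False by (rule no_cycle)
  qed
  show False
  proof (rule critical_contradiction[OF not_good])
    show "x \<notin> Z" using ZA by auto
    show "good W (insert x Z)"
      unfolding good_def
    proof (intro conjI ballI impI)
      show "insert x Z \<subseteq> A" using ZA x by auto
      fix u v assume uv: "u \<in> insert x Z" "v \<in> insert x Z" "u \<noteq> v"
      then consider "u = x" "v \<in> Z" | "v = x" "u \<in> Z" | "u \<in> Z" "v \<in> Z" by auto
      then show "joined W u v"
      proof cases
        case 3
        then show ?thesis using path[OF 3 uv(3)] joined_sym unfolding joined_def by metis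
      qed (use jx joined_sym in auto)
    qed
    show "missing W x + card Z + 1 = card A"
      using card_neighbours_W[of x] cardZ card_W unfolding S_def by simp
    show "card Z \<ge> 2" using S2 cardZ by simp
    show "\<exists>I. good W I \<and> x \<in> I \<and> card A \<le> card I + missing W u + missing W v"
      if uv: "u \<in> Z" "v \<in> Z" "u \<noteq> v" for u v
    proof -
      obtain P where P: "ham W P" "(hd P = u \<and> last P = v) \<or> (hd P = v \<and> last P = u)"
        "x \<notin> blocked P" "x \<notin> blocked (rev P)" using path[OF uv] by blast
      have "hd P \<in> A" "last P \<in> A" using P(2) uv ZA by auto
      then have "good W (A - blocked P - blocked (rev P))" using good_unblocked[OF P(1)] by blast
      moreover have "card A \<le> card (A - blocked P - blocked (rev P)) + missing W u + missing W v"
        using card_unblocked[OF P(1) W_subset] P(2) by auto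
      ultimately show ?thesis using P(3,4) x by blast
    qed
  qed
qed

end

section \<open>Consequences of 2-connectedness\<close>

context bigraph
begin

lemma connected_neighbour:
  assumes "connected_induced E S" "c \<in> S" "d \<in> S" "c \<noteq> d"
  shows "\<exists>z\<in>S. E c z"
proof -
  have "(\<lambda>a b. a \<in> S \<and> b \<in> S \<and> E a b)\<^sup>*\<^sup>* c d" using assms unfolding connected_induced_def by blast
  then show ?thesis using assms(4) by (cases rule: converse_rtranclpE) auto
qed

text \<open>Otherwise a walk from \<open>r\<close> never gets beyond \<open>r\<close> and its
  neighbours, but \<open>p\<close> is neither, lying on the same side as \<open>r\<close>.\<close>

lemma connected_common:
  assumes "connected_induced E S" "r \<in> S" "p \<in> S" "r \<noteq> p" "r \<notin> Y" "p \<notin> Y"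
  shows "\<exists>a\<in>S. \<exists>q\<in>S. q \<notin> Y \<and> q \<noteq> r \<and> E r a \<and> E q a"
proof (rule ccontr)
  assume no: "\<not> ?thesis"
  have "(\<lambda>a b. a \<in> S \<and> b \<in> S \<and> E a b)\<^sup>*\<^sup>* r p" using assms unfolding connected_induced_def by blast
  then have "p = r \<or> E r p"
  proof (induction rule: rtranclp_induct)
    case (step z z')
    show ?case
    proof (cases "z = r")
      case False
      then have "E r z" "z \<in> S" "z' \<in> S" "E z z'" using step by auto
      moreover have "z' \<notin> Y" using calculation bip assms(5) by blast
      ultimately show ?thesis using no sym by blast
    qed (use step in auto)
  qed auto
  then show False using assms bip by blast
qed

text \<open>Connectedness gives one neighbour \<open>p\<close>, and connectedness after deleting
  \<open>p\<close> gives the second.\<close>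

lemma two_connected_two_neighbours:
  assumes "two_connected_induced E (A' \<union> B)" "A' \<inter> Y = {}" "B \<subseteq> Y" "card A' \<ge> 3" "b \<in> B"
  shows "\<exists>p\<in>A'. \<exists>q\<in>A'. p \<noteq> q \<and> E b p \<and> E b q"
proof -
  have fin: "finite A'" using assms(4) by (metis card.infinite not_numeral_le_zero)
  have conn: "connected_induced E (A' \<union> B)" "\<And>v. v \<in> A' \<union> B \<Longrightarrow> connected_induced E (A' \<union> B - {v})"
    using assms(1) unfolding two_connected_induced_def by auto
  have "A' \<noteq> {}" using assms(4) by auto
  then obtain s where "s \<in> A'" by auto
  then obtain p where p: "p \<in> A' \<union> B" "E b p"
    using connected_neighbour[OF conn(1), of b s] assms by blast
  have pA: "p \<in> A'" using p bip[OF p(2)] assms by auto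
  have "A' - {p} \<noteq> {}" using assms(4) fin pA by (metis card_Diff_singleton card.empty diff_is_0_eq not_numeral_le_zero numeral_le_one_iff order_trans semiring_norm(70))
  then obtain s' where "s' \<in> A' - {p}" by auto
  then obtain q where q: "q \<in> A' \<union> B - {p}" "E b q"
    using connected_neighbour[OF conn(2)[of p], of b s'] assms pA p by blast
  have "q \<in> A'" using q bip[OF q(2)] assms by auto
  then show ?thesis using p q pA by blast
qed

text \<open>After deleting \<open>q\<close> only \<open>p\<close> can share a neighbour with
  \<open>r\<close>, and vice versa. Deleting a common neighbour \<open>a\<close> instead yields
  another one, so the two nonempty sets of common neighbours have distinct representatives.\<close>

lemma two_connected_triple:
  assumes "two_connected_induced E ({p, q, r} \<union> B)" "{p, q, r} \<inter> Y = {}" "B \<subseteq> Y"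
    and "p \<noteq> q" "q \<noteq> r" "p \<noteq> r"
  shows "\<exists>a b. a \<noteq> b \<and> E r a \<and> E p a \<and> E r b \<and> E q b"
proof -
  let ?S = "{p, q, r} \<union> B"
  have conn: "connected_induced E ?S" "\<And>v. v \<in> ?S \<Longrightarrow> connected_induced E (?S - {v})"
    using assms(1) unfolding two_connected_induced_def by auto
  have a: "\<exists>a. E r a \<and> E p a"
    using connected_common[OF conn(2)[of q], of r p] assms by blast
  have b: "\<exists>a. E r a \<and> E q a"
    using connected_common[OF conn(2)[of p], of r q] assms by blast
  have c: "\<exists>b. b \<noteq> a \<and> E r b \<and> (E p b \<or> E q b)" if a: "E r a" for a
  proof -
    have "a \<in> Y" using bip[OF a] assms(2) by auto
    then have *: "connected_induced E (?S - {a})" "r \<in> ?S - {a}" "p \<in> ?S - {a}"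
      using conn assms(2) by (cases "a \<in> ?S"; auto)+
    then obtain b s where "b \<in> ?S - {a}" "s \<in> ?S - {a}" "s \<notin> Y" "s \<noteq> r" "E r b" "E s b"
      using connected_common[OF *] assms by blast
    then show ?thesis using assms(3) by blast
  qed
  obtain a0 where "E r a0" "E p a0" using a by blast
  moreover obtain b0 where "E r b0" "E q b0" using b by blast
  ultimately show ?thesis using c[of a0] by metis
qed

end

text \<open>Hall's theorem for three sets; the last assumption says that their union has at least
  three elements.\<close>

lemma three_representatives:
  assumes "\<exists>a b. a \<noteq> b \<and> P a \<and> Q b" "\<exists>a b. a \<noteq> b \<and> P a \<and> R b" "\<exists>a b. a \<noteq> b \<and> Q a \<and> R b"
    and "\<And>a b. \<exists>c. c \<noteq> a \<and> c \<noteq> b \<and> (P c \<or> Q c \<or> R c)"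
  shows "\<exists>a b c. a \<noteq> b \<and> b \<noteq> c \<and> a \<noteq> c \<and> P a \<and> Q b \<and> R c"
proof (rule ccontr)
  assume no: "\<not> ?thesis"
  have no': False if "a \<noteq> b" "b \<noteq> c" "a \<noteq> c" "P a" "Q b" "R c" for a b c
    using no that by blast
  obtain a b where ab: "a \<noteq> b" "P a" "Q b" using assms(1) by blast
  have R: "z = a \<or> z = b" if "R z" for z using no'[of a b z] ab that by blast
  obtain c where c: "c \<noteq> a" "c \<noteq> b" "P c \<or> Q c \<or> R c" using assms(4)[of a b] by blast
  then consider "P c" | "Q c" using R by blast
  then show False
  proof cases
    case 1
    have "z = b" if "R z" for z using no'[of c b z] R[OF that] ab c 1 that by blast
    moreover obtain q r where "q \<noteq> r" "Q q" "R r" using assms(3) by blast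
    ultimately show False using no'[of a q b] no'[of c q b] ab c 1 by blast
  next
    case 2
    have "z = a" if "R z" for z using no'[of a c z] R[OF that] ab c 2 that by blast
    moreover obtain q r where "q \<noteq> r" "P q" "R r" using assms(2) by blast
    ultimately show False using no'[of q b a] no'[of q c a] ab c 2 by blast
  qed
qed

section \<open>Three-element sets and the induction\<close>

lemma bigraph_subset:
  assumes "bipartite_graph E X Y" "A \<subseteq> X"
  shows "bigraph E A Y"
proof
  show "finite A" using assms finite_subset unfolding bipartite_graph_def by auto
qed (use assms in \<open>unfold bipartite_graph_def, blast+\<close>)

lemma cycle_starting_outside:
  assumes "bigraph E A Y" "is_cycle E C"
  obtains C' where "distinct C'" "successively E C'" "E (last C') (hd C')" "set C' = set C" "C' \<noteq> []" "hd C' \<notin> Y"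
proof -
  interpret bigraph E A Y by fact
  note C = is_cycleD[OF assms(2)]
  show thesis
  proof (cases "hd C \<in> Y")
    case False
    then show ?thesis using that[of C] C by auto
  next
    case True
    obtain y z R where R: "C = y # z # R" using C(1) by (auto simp: numeral_3_eq_3 Suc_le_length_iff)
    have "z \<notin> Y" using True bip[of y z] C(3) R by auto
    moreover have "successively E ((z # R) @ [y])"
      using C(3,4) unfolding R successively_append_iff by (auto split: if_splits)
    ultimately show ?thesis using that[of "(z # R) @ [y]"] C(2,3) unfolding R by auto
  qed
qed

text \<open>The hexagon needs distinct common neighbours for the three pairs. Hall's condition for
  two pairs is \<open>two_connected_triple\<close>; for all three it follows from
  \<open>card B \<ge> 3\<close>, as each vertex of \<open>B\<close> is adjacent to two of
  \<open>p\<close>, \<open>q\<close>, \<open>r\<close>.\<close>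

lemma triangle_cycle:
  assumes "bipartite_graph E X Y" "{p, q, r} \<subseteq> X" "p \<noteq> q" "q \<noteq> r" "p \<noteq> r"
    and B: "B \<subseteq> Y" "card B \<ge> 3" "two_connected_induced E ({p, q, r} \<union> B)"
  shows "\<exists>C. is_cycle E C \<and> set C \<inter> X = {p, q, r}"
proof -
  interpret bigraph E "{p, q, r}" Y using bigraph_subset assms by blast
  define J where "J u v a \<longleftrightarrow> E u a \<and> E v a" for u v a
  have t: "\<exists>a b. a \<noteq> b \<and> J u w a \<and> J v w b"
    if "{u, v, w} = {p, q, r}" "u \<noteq> v" "v \<noteq> w" "u \<noteq> w" for u v w
    using two_connected_triple[of u v w B] that disjoint B unfolding J_def by auto
  have c: "\<exists>c. c \<noteq> a \<and> c \<noteq> b \<and> (J p q c \<or> J q r c \<or> J r p c)" for a b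
  proof -
    have "\<not> B \<subseteq> {a, b}"
    proof
      assume "B \<subseteq> {a, b}"
      then have "card B \<le> card {a, b}" by (intro card_mono) auto
      also have "\<dots> \<le> 2" by (simp add: card_insert_if)
      finally show False using B(2) by simp
    qed
    then obtain c where c: "c \<in> B" "c \<noteq> a" "c \<noteq> b" by auto
    have "card {p, q, r} \<ge> 3" using assms(3-5) by simp
    then obtain u v where "u \<in> {p, q, r}" "v \<in> {p, q, r}" "u \<noteq> v" "E c u" "E c v"
      using two_connected_two_neighbours[OF B(3) disjoint B(1) _ c(1)] by blast
    then have "J p q c \<or> J q r c \<or> J r p c" using sym unfolding J_def by blast
    then show ?thesis using c by blast
  qed
  have Jc: "J u v = J v u" for u v unfolding J_def by auto
  have "\<exists>a b c. a \<noteq> b \<and> b \<noteq> c \<and> a \<noteq> c \<and> J p q a \<and> J q r b \<and> J r p c"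
  proof (rule three_representatives[OF _ _ _ c])
    show "\<exists>a b. a \<noteq> b \<and> J p q a \<and> J q r b" using t[of p r q] assms(3-5) Jc[of r q] by auto
    show "\<exists>a b. a \<noteq> b \<and> J p q a \<and> J r p b" using t[of q r p] assms(3-5) Jc[of q p] by auto
    show "\<exists>a b. a \<noteq> b \<and> J q r a \<and> J r p b" using t[of q p r] assms(3-5) Jc[of p r] by auto
  qed
  then obtain a b c where abc: "a \<noteq> b" "b \<noteq> c" "a \<noteq> c" "J p q a" "J q r b" "J r p c" by blast
  have Y: "a \<in> Y" "b \<in> Y" "c \<in> Y" using abc bip disjoint unfolding J_def by blast+
  have "is_cycle E [p, a, q, b, r, c]"
    using abc Y assms(3-5) disjoint unfolding J_def by (intro is_cycleI) (auto intro: sym)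
  moreover have "set [p, a, q, b, r, c] \<inter> X = {p, q, r}"
    using assms(1,2) Y unfolding bipartite_graph_def by auto
  ultimately show ?thesis by blast
qed

lemma cycle_through_subset:
  assumes G: "bipartite_graph E X Y"
    and delta: "card X \<le> \<delta>" "card Y + 5 \<le> 3 * \<delta>" "\<And>x. x \<in> X \<Longrightarrow> \<delta> \<le> degree E x"
    and conn: "\<And>A. A \<subseteq> X \<Longrightarrow> card A \<ge> 3 \<Longrightarrow>
      \<exists>B \<subseteq> Y. card B \<ge> card A \<and> two_connected_induced E (A \<union> B)"
  shows "A \<subseteq> X \<Longrightarrow> card A \<ge> 3 \<Longrightarrow> \<exists>C. is_cycle E C \<and> set C \<inter> X = A"
proof (induction "card A" arbitrary: A rule: less_induct)
  case less
  have XY: "X \<inter> Y = {}" "finite X" "finite Y" and edges: "\<And>u v. E u v \<Longrightarrow> u \<in> X \<union> Y"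
    using G unfolding bipartite_graph_def by blast+
  obtain B where B: "B \<subseteq> Y" "card B \<ge> card A" "two_connected_induced E (A \<union> B)"
    using conn[OF less.prems] by blast
  show ?case
  proof (cases "card A = 3")
    case True
    then obtain p q r where "A = {p, q, r}" "p \<noteq> q" "q \<noteq> r" "p \<noteq> r" by (auto simp: card_3_iff)
    then show ?thesis using triangle_cycle[OF G, of p q r B] less.prems B by auto
  next
    case False
    then have A4: "card A \<ge> 4" using less.prems by simp
    have bA: "bigraph E A Y" using bigraph_subset[OF G less.prems(1)] .
    interpret bigraph E A Y by fact
    show ?thesis
    proof (rule ccontr)
      assume no: "\<not> ?thesis"
      obtain x where x: "x \<in> A" using A4 by fastforce
      have "card (A - {x}) < card A" "card (A - {x}) \<ge> 3" "A - {x} \<subseteq> X"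
        using x A4 finite_A less.prems by auto
      then obtain C0 where C0: "is_cycle E C0" "set C0 \<inter> X = A - {x}" using less.hyps by blast
      obtain C where C: "distinct C" "successively E C" "E (last C) (hd C)" "set C = set C0" "C \<noteq> []" "hd C \<notin> Y"
        using cycle_starting_outside[OF bA C0(1)] .
      define W where "W = set C \<inter> Y"
      have "set C \<subseteq> X \<union> Y"
      proof
        fix v assume "v \<in> set C"
        then obtain F G where FG: "C = F @ v # G" by (meson split_list)
        show "v \<in> X \<union> Y"
        proof (cases G)
          case Nil
          then show ?thesis using edges C(3) FG by auto
        next
          case (Cons w H)
          then show ?thesis using edges[of v w] C(2) FG by (auto simp: successively_append_iff)
        qed
      qed
      then have setC: "set C = (A - {x}) \<union> W" using C0(2) C(4) unfolding W_def by blast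
      have hdA: "hd C \<in> A" using hd_in_set[OF C(5)] C(6) setC unfolding W_def by blast
      have lastY: "last C \<in> Y" using bip[OF C(3)] C(6) by auto
      have "set C - Y = A - {x}" using setC disjoint unfolding W_def by blast
      then have "card (A - {x}) = card W"
        using alternating_card[OF C(2,1,5,6)] lastY unfolding W_def by simp
      then have cW: "card A = Suc (card W)" using x finite_A A4 by simp
      interpret critical_bigraph E A Y W \<delta>
      proof
        show "W \<subseteq> Y" unfolding W_def by auto
        show "card A \<le> \<delta>" using card_mono[OF XY(2) less.prems(1)] delta(1) by simp
        fix C' assume "is_cycle E C'" "A \<subseteq> set C'" "set C' \<subseteq> A \<union> Y"
        then have "set C' \<inter> X = A" using less.prems(1) XY(1) by auto
        then show False using no \<open>is_cycle E C'\<close> by blast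
      qed (use cW A4 delta less.prems in auto)
      \<comment> \<open>Since \<open>B\<close> is larger than \<open>W\<close>, some
        \<open>b\<close> in \<open>B\<close> lies outside \<open>W\<close>, and two vertices of
        \<open>A\<close> adjacent to it cannot be joined.\<close>
      have not_good: "\<not> good W A"
      proof
        assume g: "good W A"
        have "card W < card B" using B(2) cW by simp
        then have "\<not> B \<subseteq> W" using card_mono[OF finite_W] by (meson not_less)
        then obtain b where b: "b \<in> B" "b \<notin> W" by auto
        obtain p q where pq: "p \<in> A" "q \<in> A" "p \<noteq> q" "E b p" "E b q"
          using two_connected_two_neighbours[OF B(3) disjoint B(1) less.prems(2) b(1)] by blast
        then have "b \<in> outside W p \<inter> outside W q" using b B(1) sym unfolding outside_def by auto
        then show False using joined_disjoint[of p q] g pq unfolding good_def by auto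
      qed
      show False
      proof (rule cycle_contradiction[OF C(1-3) setC C(5) hdA x not_good])
        fix p q assume pq: "p \<in> A" "q \<in> A" "p \<noteq> q" "p \<noteq> x" "q \<noteq> x"
        then have "{p, q, x} \<subseteq> X" "card {p, q, x} \<ge> 3" using x less.prems(1) by auto
        then obtain B' where "B' \<subseteq> Y" "two_connected_induced E ({p, q, x} \<union> B')"
          using conn by blast
        then show "\<exists>a b. a \<noteq> b \<and> E x a \<and> E p a \<and> E x b \<and> E q b"
          using two_connected_triple[of p q x B'] pq x disjoint by auto
      qed
    qed
  qed
qed

theorem theorem8:
  fixes E :: "'a \<Rightarrow> 'a \<Rightarrow> bool" and X Y :: "'a set" and n m \<delta> :: nat
  assumes "bipartite_graph E X Y"
    and "card X = n" and "card Y = m"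
    and "n \<ge> 2" and "\<delta> \<ge> n" and "int m \<le> 3 * int \<delta> - 5"
    and "\<forall>x\<in>X. degree E x \<ge> \<delta>"
    and "\<forall>A \<subseteq> X. card A \<ge> 3 \<longrightarrow>
           (\<exists>B \<subseteq> Y. card B \<ge> card A \<and> two_connected_induced E (A \<union> B))"
  shows "X_super_pancyclic E X"
  unfolding X_super_pancyclic_def
proof (intro allI impI)
  fix X' assume "X' \<subseteq> X" "3 \<le> card X'"
  then show "\<exists>C. is_cycle E C \<and> set C \<inter> X = X'"
    using assms by (intro cycle_through_subset[of E X Y \<delta>]) auto
qed

end
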